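(* Let $G$ be a finite group acting transitively on a finite set $X$ via a homomorphism $\sigma\colon G\to S_X$. Fix a base point $x_0\in X$ with stabilizer $H\le G$, and select elements $\{t_x\}_{x\in X}\subseteq G$ with $\sigma(t_x)x_0=x$ for each $x\in X$. Let $\mathbb{F}\in\{\mathbb{R},\mathbb{C}\}$, let $\rho\colon G\to \operatorname{U}(\mathbb{F}^d)$ be an irreducible unitary representation, and let $W\le\mathbb{F}^d$ be a subspace with $\rho(h)W=W$ for every $h\in H$. Then the ensemble $\mathcal{W}:=\{\rho(t_x)W\}_{x\in X}$ is a tight fusion frame for $\mathbb{F}^d$ whose automorphism group contains $\sigma(G)\le S_X$. Furthermore, if $G$ acts doubly homogeneously on $X$, then: (a) $\mathcal{W}$ is an equi-chordal tight fusion frame; and (b) when $|X|\ge 2$, $\mathcal{W}$ is an equi-isoclinic tight fusion frame if and only if there exists $g\in G\setminus H$ such that $W$ and $\rho(g)W$ are isoclinic.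
   Context: For an ensemble $\{W_x\}_{x\in X}$ of $r$-dimensional subspaces of a finite-dimensional Hilbert space $V$ over $\mathbb{F}$, let $P_x$ denote orthogonal projection onto $W_x$. It is a tight fusion frame if $\sum_{x}P_x$ is a scalar multiple of the identity. For isometries $\Phi_x\colon\mathbb{F}^r\to V$ with image $W_x$, two subspaces $W_x,W_y$ are $\alpha$-isoclinic if $(\Phi_x^*\Phi_y)^*(\Phi_x^*\Phi_y)=\alpha I$ (and "isoclinic" means $\alpha$-isoclinic for some $\alpha$); the ensemble is equi-isoclinic if there is a single $\alpha$ with $W_x,W_y$ $\alpha$-isoclinic for all $x\neq y$. The chordal distance is $\operatorname{dist}_c(W_x,W_y)=\sqrt{r-\|\Phi_x^*\Phi_y\|_F^2}$. An equi-chordal tight fusion frame (ECTFF) is a tight fusion frame whose chordal distances $\operatorname{dist}_c(W_x,W_y)$, $x\ne y$, are all equal; an equi-isoclinic tight fusion frame (EITFF) is a tight fusion frame that is equi-isoclinic. The automorphism group of $\{W_x\}_{x\in X}$ is the set of permutations $\tau\in S_X$ for which there is a unitary $U$ on $V$ with $UW_x=W_{\tau(x)}$ for all $x$. $G$ acts doubly homogeneously on $X$ if for any two unordered pairs $\{x,y\},\{x',y'\}$ of distinct points there is $g\in G$ with $\{\sigma(g)x,\sigma(g)y\}=\{x',y'\}$. *)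

theory Defs
  imports "HOL-Analysis.Analysis" "HOL-Algebra.Group_Action"
begin

text \<open>
  The ground field is \<open>\<real>\<close> or \<open>\<complex>\<close>. The class below consists exactly of the normed fields that
  are identified, by a real-linear isometric field embedding into \<^typ>\<open>complex\<close>, with the reals
  or with all of \<^typ>\<open>complex\<close>; the types \<^typ>\<open>real\<close> and \<^typ>\<open>complex\<close> themselves are its
  instances.
\<close>

class real_or_complex = real_normed_field + euclidean_space +
  fixes to_complex :: "'a \<Rightarrow> complex"
  assumes to_complex_add: "to_complex (x + y) = to_complex x + to_complex y"
    and to_complex_mult: "to_complex (x * y) = to_complex x * to_complex y"
    and to_complex_scaleR: "to_complex (c *\<^sub>R x) = c *\<^sub>R to_complex x"
    and norm_to_complex: "norm (to_complex x) = norm x"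
    and range_to_complex: "range to_complex = \<real> \<or> range to_complex = UNIV"

instantiation real :: real_or_complex
begin

definition to_complex_real :: "real \<Rightarrow> complex"
  where "to_complex_real = complex_of_real"

instance
  by standard (auto simp: to_complex_real_def scaleR_conv_of_real Reals_def)

end

instantiation complex :: real_or_complex
begin

definition to_complex_complex :: "complex \<Rightarrow> complex"
  where "to_complex_complex z = z"

instance
  by standard (auto simp: to_complex_complex_def)

end

definition fcnj :: "'a::real_or_complex \<Rightarrow> 'a"
  where "fcnj x = (THE y. to_complex y = cnj (to_complex x))"

lemma to_complex_eq_iff: "to_complex x = to_complex y \<longleftrightarrow> x = y"
proof
  assume eq: "to_complex x = to_complex y"
  have "to_complex x = to_complex (x - y) + to_complex y"
    by (simp flip: to_complex_add)
  with eq have "norm (to_complex (x - y)) = 0"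
    by simp
  then show "x = y"
    by (simp add: norm_to_complex)
qed simp

lemma to_complex_fcnj: "to_complex (fcnj x) = cnj (to_complex x)"
proof -
  have "cnj (to_complex x) \<in> range (to_complex :: 'a \<Rightarrow> complex)"
    using range_to_complex[where 'a = 'a] rangeI[of to_complex x]
    by (metis Reals_cnj_iff UNIV_I)
  then obtain y where y: "to_complex (y :: 'a) = cnj (to_complex x)"
    by auto
  have "to_complex (THE y :: 'a. to_complex y = cnj (to_complex x)) = cnj (to_complex x)"
    by (rule theI[where a = y]) (use y to_complex_eq_iff in \<open>metis+\<close>)
  then show ?thesis
    unfolding fcnj_def .
qed

lemma fcnj_real: "fcnj (x :: real) = x"
  using to_complex_fcnj[of x] by (simp add: to_complex_real_def)

lemma fcnj_complex: "fcnj (z :: complex) = cnj z"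
  using to_complex_fcnj[of z] by (simp add: to_complex_complex_def)

text \<open>The Hermitian inner product of \<open>\<FF>\<^sup>d\<close>, conjugate-linear in the first argument.\<close>

definition hinner :: "'f::real_or_complex ^ 'n \<Rightarrow> 'f ^ 'n \<Rightarrow> 'f"
  where "hinner v w = (\<Sum>i\<in>UNIV. fcnj (v $ i) * w $ i)"

definition conj_transpose :: "'f::real_or_complex ^ 'n ^ 'm \<Rightarrow> 'f ^ 'm ^ 'n"
  where "conj_transpose A = (\<chi> i j. fcnj (A $ j $ i))"

definition unitary_group :: "('f::real_or_complex ^ 'n ^ 'n) monoid"
  where "unitary_group =
    \<lparr>carrier = {U. conj_transpose U ** U = mat 1 \<and> U ** conj_transpose U = mat 1},
     mult = (**), one = mat 1\<rparr>"

definition irreducible_unitary_rep :: "('g, 'b) monoid_scheme \<Rightarrow> ('g \<Rightarrow> 'f::real_or_complex ^ 'n ^ 'n) \<Rightarrow> bool"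
  where "irreducible_unitary_rep G \<rho> \<longleftrightarrow>
    \<rho> \<in> hom G unitary_group \<and>
    (\<forall>S. vec.subspace S \<and> (\<forall>g\<in>carrier G. (*v) (\<rho> g) ` S \<subseteq> S) \<longrightarrow> S = {0} \<or> S = UNIV)"

definition orth_proj :: "('f::real_or_complex ^ 'n) set \<Rightarrow> 'f ^ 'n \<Rightarrow> 'f ^ 'n"
  where "orth_proj W v = (THE p. p \<in> W \<and> (\<forall>w\<in>W. hinner w (v - p) = 0))"

definition tight_fusion_frame :: "'x set \<Rightarrow> ('x \<Rightarrow> ('f::real_or_complex ^ 'n) set) \<Rightarrow> bool"
  where "tight_fusion_frame X \<W> \<longleftrightarrow>
    (\<exists>r. \<forall>x\<in>X. vec.subspace (\<W> x) \<and> vec.dim (\<W> x) = r) \<and>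
    (\<exists>a. \<forall>v. (\<Sum>x\<in>X. orth_proj (\<W> x) v) = a *s v)"

text \<open>
  A linear map \<open>\<Phi> : \<FF>\<^sup>r \<rightarrow> \<FF>\<^sup>d\<close> is represented by its columns \<open>\<Phi> 0, \<dots>, \<Phi> (r - 1)\<close>, since \<open>r\<close>
  (which may be \<open>0\<close>) is the dimension of a variable subspace and cannot be a type. Entries with index
  at least \<open>r\<close> are ignored. The first condition below is \<open>\<Phi>\<^sup>* \<Phi> = I\<close>, the second says that
  the image of \<open>\<Phi>\<close> is \<open>W\<close>.
\<close>

definition isometry_onto :: "nat \<Rightarrow> (nat \<Rightarrow> 'f::real_or_complex ^ 'n) \<Rightarrow> ('f ^ 'n) set \<Rightarrow> bool"
  where "isometry_onto r \<Phi> W \<longleftrightarrow>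
    (\<forall>i<r. \<forall>j<r. hinner (\<Phi> i) (\<Phi> j) = (if i = j then 1 else 0)) \<and>
    range (\<lambda>c. \<Sum>j<r. c j *s \<Phi> j) = W"

text \<open>The entries of the \<open>r \<times> r\<close> matrix \<open>\<Phi>\<^sup>* \<Psi>\<close>.\<close>

definition cross_gram :: "(nat \<Rightarrow> 'f::real_or_complex ^ 'n) \<Rightarrow> (nat \<Rightarrow> 'f ^ 'n) \<Rightarrow> nat \<Rightarrow> nat \<Rightarrow> 'f"
  where "cross_gram \<Phi> \<Psi> i j = hinner (\<Phi> i) (\<Psi> j)"

text \<open>
  The displayed condition is \<open>(\<Phi>\<^sup>* \<Psi>)\<^sup>* (\<Phi>\<^sup>* \<Psi>) = \<alpha> I\<close>. That neither this notion nor the chordal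
  distance depends on the chosen isometries is shown below in \<open>isoclinic_with_iff\<close> and
  \<open>chordal_dist_eq\<close>.
\<close>

definition isoclinic_with :: "'f::real_or_complex \<Rightarrow> ('f ^ 'n) set \<Rightarrow> ('f ^ 'n) set \<Rightarrow> bool"
  where "isoclinic_with \<alpha> V W \<longleftrightarrow>
    (\<exists>r \<Phi> \<Psi>. isometry_onto r \<Phi> V \<and> isometry_onto r \<Psi> W \<and>
      (\<forall>i<r. \<forall>j<r. (\<Sum>k<r. fcnj (cross_gram \<Phi> \<Psi> k i) * cross_gram \<Phi> \<Psi> k j) =
        (if i = j then \<alpha> else 0)))"

definition isoclinic :: "('f::real_or_complex ^ 'n) set \<Rightarrow> ('f ^ 'n) set \<Rightarrow> bool"
  where "isoclinic V W \<longleftrightarrow> (\<exists>\<alpha>. isoclinic_with \<alpha> V W)"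

definition chordal_dist :: "('f::real_or_complex ^ 'n) set \<Rightarrow> ('f ^ 'n) set \<Rightarrow> real"
  where "chordal_dist V W =
    (THE \<delta>. \<exists>r \<Phi> \<Psi>. isometry_onto r \<Phi> V \<and> isometry_onto r \<Psi> W \<and>
      \<delta> = sqrt (real r - (\<Sum>i<r. \<Sum>j<r. (norm (cross_gram \<Phi> \<Psi> i j))\<^sup>2)))"

definition equichordal_tight_fusion_frame ::
    "'x set \<Rightarrow> ('x \<Rightarrow> ('f::real_or_complex ^ 'n) set) \<Rightarrow> bool"
  where "equichordal_tight_fusion_frame X \<W> \<longleftrightarrow> tight_fusion_frame X \<W> \<and>
    (\<exists>\<delta>. \<forall>x\<in>X. \<forall>y\<in>X. x \<noteq> y \<longrightarrow> chordal_dist (\<W> x) (\<W> y) = \<delta>)"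

definition equiisoclinic_tight_fusion_frame ::
    "'x set \<Rightarrow> ('x \<Rightarrow> ('f::real_or_complex ^ 'n) set) \<Rightarrow> bool"
  where "equiisoclinic_tight_fusion_frame X \<W> \<longleftrightarrow> tight_fusion_frame X \<W> \<and>
    (\<exists>\<alpha>. \<forall>x\<in>X. \<forall>y\<in>X. x \<noteq> y \<longrightarrow> isoclinic_with \<alpha> (\<W> x) (\<W> y))"

definition ensemble_automorphisms ::
    "'x set \<Rightarrow> ('x \<Rightarrow> ('f::real_or_complex ^ 'n) set) \<Rightarrow> ('x \<Rightarrow> 'x) set"
  where "ensemble_automorphisms X \<W> =
    {\<tau> \<in> carrier (BijGroup X). \<exists>U\<in>carrier unitary_group. \<forall>x\<in>X. (*v) U ` \<W> x = \<W> (\<tau> x)}"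

definition doubly_homogeneous :: "('g, 'b) monoid_scheme \<Rightarrow> 'x set \<Rightarrow> ('g \<Rightarrow> 'x \<Rightarrow> 'x) \<Rightarrow> bool"
  where "doubly_homogeneous G X \<sigma> \<longleftrightarrow>
    (\<forall>x\<in>X. \<forall>y\<in>X. \<forall>x'\<in>X. \<forall>y'\<in>X. x \<noteq> y \<longrightarrow> x' \<noteq> y' \<longrightarrow>
      (\<exists>g\<in>carrier G. {\<sigma> g x, \<sigma> g y} = {x', y'}))"

lemma fcnj_add: "fcnj (x + y) = fcnj x + fcnj y"
  and fcnj_mult: "fcnj (x * y) = fcnj x * fcnj y"
  and fcnj_fcnj: "fcnj (fcnj x) = x"
  by (rule to_complex_eq_iff[THEN iffD1],
      simp add: to_complex_add to_complex_mult to_complex_fcnj)+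

lemma fcnj_zero: "fcnj 0 = 0"
  using fcnj_add[of 0 0] by simp

lemma to_complex_of_real: "to_complex (of_real c) = of_real c"
proof -
  have "to_complex (1 :: 'a) * to_complex (1 :: 'a) = to_complex (1 :: 'a)"
    by (simp flip: to_complex_mult)
  moreover have "to_complex (1 :: 'a) \<noteq> 0"
    using norm_to_complex[of "1 :: 'a"] by auto
  ultimately have "to_complex (1 :: 'a) = 1"
    by simp
  then show ?thesis
    by (simp add: of_real_def to_complex_scaleR)
qed

lemma fcnj_mult_self: "fcnj x * x = of_real ((norm x)\<^sup>2)"
  by (rule to_complex_eq_iff[THEN iffD1])
    (metis complex_norm_square mult.commute norm_to_complex to_complex_fcnj to_complex_mult
      to_complex_of_real)

lemma fcnj_sum: "fcnj (sum f A) = (\<Sum>a\<in>A. fcnj (f a))"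
  by (induction A rule: infinite_finite_induct) (auto simp: fcnj_zero fcnj_add)

lemma hinner_sum_right: "hinner v (\<Sum>a\<in>A. c a *s f a) = (\<Sum>a\<in>A. c a * hinner v (f a))"
proof -
  have "hinner v (\<Sum>a\<in>A. c a *s f a) = (\<Sum>i\<in>UNIV. \<Sum>a\<in>A. c a * (fcnj (v $ i) * f a $ i))"
    by (simp add: hinner_def sum_distrib_left mult_ac)
  also have "\<dots> = (\<Sum>a\<in>A. c a * hinner v (f a))"
    by (subst sum.swap) (simp add: hinner_def sum_distrib_left)
  finally show ?thesis .
qed

lemma hinner_diff_right: "hinner v (x - y) = hinner v x - hinner v y"
  by (simp add: hinner_def algebra_simps sum_subtractf)

lemma fcnj_hinner: "fcnj (hinner v w) = hinner w v"
  by (simp add: hinner_def fcnj_sum fcnj_mult fcnj_fcnj mult.commute)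

lemma hinner_sum_left: "hinner (\<Sum>a\<in>A. c a *s f a) v = (\<Sum>a\<in>A. fcnj (c a) * hinner (f a) v)"
  by (subst fcnj_hinner[symmetric]) (simp add: hinner_sum_right fcnj_sum fcnj_mult fcnj_hinner)

lemma hinner_self_eq_zero: "hinner v v = 0 \<longleftrightarrow> v = 0"
proof
  assume "hinner v v = 0"
  then have "of_real (\<Sum>i\<in>UNIV. (norm (v $ i))\<^sup>2) = (0 :: 'a)"
    by (simp add: hinner_def fcnj_mult_self)
  then have "(\<Sum>i\<in>UNIV. (norm (v $ i))\<^sup>2) = 0"
    by (simp only: of_real_eq_0_iff)
  then show "v = 0"
    by (simp add: sum_nonneg_eq_0_iff vec_eq_iff)
qed (simp add: hinner_def)

lemma isometry_onto_sum_mem: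
  assumes "isometry_onto r \<Phi> W"
  shows "(\<Sum>j<r. c j *s \<Phi> j) \<in> W"
  using assms unfolding isometry_onto_def by blast

lemma isometry_onto_mem:
  assumes "isometry_onto r \<Phi> W" "i < r"
  shows "\<Phi> i \<in> W"
proof -
  have "(\<Sum>j<r. (if j = i then 1 else 0) *s \<Phi> j) = (\<Sum>j<r. if j = i then \<Phi> j else 0)"
    by (rule sum.cong) auto
  also have "\<dots> = \<Phi> i"
    using assms by simp
  finally show ?thesis
    using isometry_onto_sum_mem[OF assms(1)] by metis
qed

lemma hinner_isometry_sum:
  assumes "isometry_onto r \<Phi> W" "i < r"
  shows "hinner (\<Phi> i) (\<Sum>j<r. c j *s \<Phi> j) = c i"
proof -
  have "hinner (\<Phi> i) (\<Sum>j<r. c j *s \<Phi> j) = (\<Sum>j<r. if j = i then c j else 0)"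
    unfolding hinner_sum_right using assms by (intro sum.cong) (auto simp: isometry_onto_def)
  then show ?thesis
    using assms by simp
qed

lemma isometry_onto_hinner_sum:
  assumes "isometry_onto r \<Phi> W" "u \<in> W"
  shows "hinner u (\<Sum>k<r. hinner (\<Phi> k) v *s \<Phi> k) = hinner u v"
proof -
  obtain c where u: "u = (\<Sum>j<r. c j *s \<Phi> j)"
    using assms unfolding isometry_onto_def by auto
  show ?thesis
    unfolding u hinner_sum_left using hinner_isometry_sum[OF assms(1)] by (intro sum.cong) auto
qed

lemma isometry_onto_diff:
  assumes "isometry_onto r \<Phi> W" "u \<in> W" "v \<in> W"
  shows "u - v \<in> W"
proof -
  obtain c d where "u = (\<Sum>j<r. c j *s \<Phi> j)" "v = (\<Sum>j<r. d j *s \<Phi> j)"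
    using assms unfolding isometry_onto_def by blast
  then have "u - v = (\<Sum>j<r. (c j - d j) *s \<Phi> j)"
    by (simp add: vec.scale_left_diff_distrib sum_subtractf)
  then show ?thesis
    using isometry_onto_sum_mem[OF assms(1), of "\<lambda>j. c j - d j"] by (simp only:)
qed

lemma orth_proj_isometry:
  assumes "isometry_onto r \<Phi> W"
  shows "orth_proj W v = (\<Sum>k<r. hinner (\<Phi> k) v *s \<Phi> k)" (is "_ = ?p")
  unfolding orth_proj_def
proof (rule the_equality)
  have p: "?p \<in> W"
    by (rule isometry_onto_sum_mem[OF assms])
  then show "?p \<in> W \<and> (\<forall>w\<in>W. hinner w (v - ?p) = 0)"
    using isometry_onto_hinner_sum[OF assms] by (simp add: hinner_diff_right)
  fix q assume q: "q \<in> W \<and> (\<forall>w\<in>W. hinner w (v - q) = 0)"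
  have d: "q - ?p \<in> W"
    using isometry_onto_diff[OF assms] p q by blast
  have "hinner (q - ?p) (q - ?p) = 0"
    using isometry_onto_hinner_sum[OF assms d] q d by (simp add: hinner_diff_right)
  then show "q = ?p"
    by (simp add: hinner_self_eq_zero)
qed

lemma gram_eq_hinner_orth_proj:
  assumes "isometry_onto r \<Phi> V"
  shows "(\<Sum>k<r. fcnj (cross_gram \<Phi> \<Psi> k i) * cross_gram \<Phi> \<Psi> k j) =
    hinner (\<Psi> i) (orth_proj V (\<Psi> j))"
  unfolding orth_proj_isometry[OF assms] hinner_sum_right
  by (simp add: cross_gram_def fcnj_hinner mult.commute)

lemma gram_scalar_iff:
  assumes \<Phi>: "isometry_onto r \<Phi> V" and \<Psi>: "isometry_onto r \<Psi> W"
  shows "(\<forall>i<r. \<forall>j<r. (\<Sum>k<r. fcnj (cross_gram \<Phi> \<Psi> k i) * cross_gram \<Phi> \<Psi> k j) =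
      (if i = j then \<alpha> else 0)) \<longleftrightarrow>
    (\<forall>u\<in>W. \<forall>w\<in>W. hinner u (orth_proj V w) = \<alpha> * hinner u w)" (is "?L \<longleftrightarrow> ?R")
proof
  assume ?R
  then show ?L
    using isometry_onto_mem[OF \<Psi>] \<Psi>
    by (simp add: gram_eq_hinner_orth_proj[OF \<Phi>]) (simp add: isometry_onto_def)
next
  assume ?L
  then have L: "hinner (\<Psi> i) (orth_proj V (\<Psi> j)) = \<alpha> * hinner (\<Psi> i) (\<Psi> j)"
    if "i < r" "j < r" for i j
    using that \<Psi> by (simp add: gram_eq_hinner_orth_proj[OF \<Phi>]) (simp add: isometry_onto_def)
  have proj: "hinner u (orth_proj V (\<Sum>j<r. d j *s \<Psi> j)) =
      (\<Sum>j<r. d j * hinner u (orth_proj V (\<Psi> j)))" for u d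
    unfolding orth_proj_isometry[OF \<Phi>] hinner_sum_right sum_distrib_left sum_distrib_right
    by (subst sum.swap) (simp add: mult_ac)
  show ?R
  proof (intro ballI)
    fix u w assume "u \<in> W" "w \<in> W"
    then obtain c d where u: "u = (\<Sum>j<r. c j *s \<Psi> j)" and w: "w = (\<Sum>j<r. d j *s \<Psi> j)"
      using \<Psi> unfolding isometry_onto_def by blast
    have "hinner u (orth_proj V w) =
        (\<Sum>j<r. d j * (\<Sum>i<r. fcnj (c i) * hinner (\<Psi> i) (orth_proj V (\<Psi> j))))"
      unfolding w proj u hinner_sum_left ..
    also have "\<dots> = (\<Sum>j<r. d j * (\<Sum>i<r. fcnj (c i) * (\<alpha> * hinner (\<Psi> i) (\<Psi> j))))"
      by (intro sum.cong refl arg_cong2[where f = "(*)"]) (auto simp: L)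
    also have "\<dots> = \<alpha> * hinner u w"
      unfolding w hinner_sum_right u hinner_sum_left by (simp add: sum_distrib_left mult_ac)
    finally show "hinner u (orth_proj V w) = \<alpha> * hinner u w" .
  qed
qed

definition cross_norm :: "nat \<Rightarrow> nat \<Rightarrow> (nat \<Rightarrow> 'f::real_or_complex ^ 'n) \<Rightarrow> (nat \<Rightarrow> 'f ^ 'n) \<Rightarrow> real"
  where "cross_norm r s \<Phi> \<Psi> = (\<Sum>i<r. \<Sum>j<s. (norm (cross_gram \<Phi> \<Psi> i j))\<^sup>2)"

lemma norm_fcnj: "norm (fcnj x) = norm x"
  by (metis complex_mod_cnj norm_to_complex to_complex_fcnj)

lemma cross_norm_commute: "cross_norm r s \<Phi> \<Psi> = cross_norm s r \<Psi> \<Phi>"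
  unfolding cross_norm_def cross_gram_def
  by (subst sum.swap, subst fcnj_hinner[symmetric]) (simp add: norm_fcnj)

lemma of_real_cross_norm:
  assumes "isometry_onto r \<Phi> (V :: ('f::real_or_complex ^ 'n) set)"
  shows "(of_real (cross_norm r s \<Phi> \<Psi>) :: 'f) = (\<Sum>j<s. hinner (\<Psi> j) (orth_proj V (\<Psi> j)))"
  unfolding cross_norm_def
  by (subst sum.swap)
    (simp add: gram_eq_hinner_orth_proj[OF assms, symmetric] fcnj_mult_self)

lemma cross_norm_cong:
  assumes "isometry_onto r \<Phi> V" "isometry_onto r' \<Phi>' V"
  shows "cross_norm r s \<Phi> \<Psi> = cross_norm r' s \<Phi>' \<Psi>"
  using of_real_cross_norm[OF assms(1), of s \<Psi>] of_real_cross_norm[OF assms(2), of s \<Psi>]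
  by (metis of_real_eq_iff)

lemma cross_norm_self:
  assumes "isometry_onto r \<Phi> V"
  shows "cross_norm r r \<Phi> \<Phi> = real r"
proof -
  have "cross_norm r r \<Phi> \<Phi> = (\<Sum>i<r. \<Sum>j<r. if j = i then 1 else 0)"
    unfolding cross_norm_def cross_gram_def using assms
    by (intro sum.cong) (auto simp: isometry_onto_def)
  then show ?thesis
    by simp
qed

lemma isometry_onto_dim_unique:
  assumes "isometry_onto r \<Phi> V" "isometry_onto r' \<Phi>' V"
  shows "r = r'"
proof -
  have "real r = cross_norm r' r \<Phi>' \<Phi>"
    using cross_norm_self[OF assms(1)] cross_norm_cong[OF assms] by simp
  also have "\<dots> = cross_norm r r' \<Phi> \<Phi>'"
    by (rule cross_norm_commute)
  also have "\<dots> = real r'"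
    using cross_norm_self[OF assms(2)] cross_norm_cong[OF assms] by simp
  finally show ?thesis
    by simp
qed

lemma isoclinic_with_iff:
  assumes "isometry_onto r \<Phi> V" "isometry_onto r \<Psi> W"
  shows "isoclinic_with \<alpha> V W \<longleftrightarrow>
    (\<forall>i<r. \<forall>j<r. (\<Sum>k<r. fcnj (cross_gram \<Phi> \<Psi> k i) * cross_gram \<Phi> \<Psi> k j) =
      (if i = j then \<alpha> else 0))"
  unfolding isoclinic_with_def gram_scalar_iff[OF assms]
  using gram_scalar_iff assms by blast

lemma chordal_dist_eq:
  assumes "isometry_onto r \<Phi> V" "isometry_onto r \<Psi> W"
  shows "chordal_dist V W = sqrt (real r - (\<Sum>i<r. \<Sum>j<r. (norm (cross_gram \<Phi> \<Psi> i j))\<^sup>2))"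
  unfolding chordal_dist_def cross_norm_def[symmetric]
proof (rule the_equality)
  fix \<delta>
  assume "\<exists>r \<Phi> \<Psi>. isometry_onto r \<Phi> V \<and> isometry_onto r \<Psi> W \<and>
    \<delta> = sqrt (real r - cross_norm r r \<Phi> \<Psi>)"
  then obtain r' \<Phi>' \<Psi>' where *: "isometry_onto r' \<Phi>' V" "isometry_onto r' \<Psi>' W"
    "\<delta> = sqrt (real r' - cross_norm r' r' \<Phi>' \<Psi>')"
    by blast
  have "r' = r"
    using isometry_onto_dim_unique *(1) assms(1) by blast
  moreover have "cross_norm r' r' \<Phi>' \<Psi>' = cross_norm r r \<Phi> \<Psi>"
    using cross_norm_cong[OF *(1) assms(1), of r' \<Psi>'] cross_norm_cong[OF *(2) assms(2), of r \<Phi>]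
    by (simp add: cross_norm_commute[of r _ \<Phi>])
  ultimately show "\<delta> = sqrt (real r - cross_norm r r \<Phi> \<Psi>)"
    using * by simp
qed (use assms in blast)

end

theory Submission
  imports Defs
begin

text \<open>
  The frame operator \<open>\<Sum>\<^sub>x P\<^sub>x\<close> is self-adjoint and commutes with the representation, because
  \<open>\<rho>(g)\<close> carries \<open>\<W> x\<close> to \<open>\<W> (\<sigma> g x)\<close>. Over \<open>\<real>\<close> as well as over \<open>\<complex>\<close> a self-adjoint operator
  has a real eigenvalue (maximise the Rayleigh quotient), and the eigenspace is invariant, hence is
  everything by irreducibility. Chordal distance and the isoclinic relation are invariant under
  unitaries and symmetric in the two subspaces, so under double homogeneity their value on one pair
  of distinct points is their value on every pair.
\<close>

section \<open>Eigenvectors of real self-adjoint operators\<close>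

lemma selfadjoint_has_eigenvector:
  fixes S :: "'a::euclidean_space \<Rightarrow> 'a"
  assumes "linear S" and sym: "\<And>u v. S u \<bullet> v = u \<bullet> S v"
  obtains a v where "v \<noteq> 0" "S v = a *\<^sub>R v"
proof -
  have cont: "continuous_on (sphere 0 1) (\<lambda>v. v \<bullet> S v)"
    using linear_continuous_on[OF linear_conv_bounded_linear[THEN iffD1, OF assms(1)]]
    by (intro continuous_intros)
  have "sphere (0::'a) 1 \<noteq> {}"
    by simp
  then obtain v where v: "norm v = 1" and max: "\<And>u. norm u = 1 \<Longrightarrow> u \<bullet> S u \<le> v \<bullet> S v"
    using continuous_attains_sup[OF compact_sphere _ cont] by auto
  define a where "a = v \<bullet> S v"
  \<comment> \<open>As \<open>a\<close> is the maximum of the form of \<open>S\<close> on the unit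
    sphere, rescaling shows that the form of \<open>T\<close> is nonnegative everywhere; it vanishes
    at \<open>v\<close>.\<close>
  define T where "T u = a *\<^sub>R u - S u" for u
  have T_sym: "T u \<bullet> w = u \<bullet> T w" for u w
    by (simp add: T_def inner_diff_left inner_diff_right sym)
  have T_add: "T (u + w) = T u + T w" and T_scale: "T (c *\<^sub>R u) = c *\<^sub>R T u" for u w c
    by (simp_all add: T_def linear_add[OF assms(1)] linear_cmul[OF assms(1)] algebra_simps)
  have T_nonneg: "0 \<le> u \<bullet> T u" for u
  proof (cases "u = 0")
    case False
    have "(u /\<^sub>R norm u) \<bullet> S (u /\<^sub>R norm u) \<le> a"
      unfolding a_def using False by (intro max) simp
    then show ?thesis
      using False
      by (simp add: T_def linear_cmul[OF assms(1)] inner_diff_right dot_square_norm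
          power2_eq_square field_simps)
  qed simp
  have vTv: "v \<bullet> T v = 0"
    using v by (simp add: T_def inner_diff_right a_def dot_square_norm)
  \<comment> \<open>The form \<open>u \<bullet> T u\<close> is positive semidefinite and vanishes at \<open>v\<close>, so its first variation
    there, in the direction \<open>T v\<close>, must vanish as well.\<close>
  have "T v = 0"
  proof (rule ccontr)
    assume "T v \<noteq> 0"
    define p q where "p = T v \<bullet> T v" and "q = T v \<bullet> T (T v)"
    have p: "p > 0" and q: "q \<ge> 0"
      using \<open>T v \<noteq> 0\<close> T_nonneg[of "T v"] by (simp_all add: p_def q_def)
    have quad: "0 \<le> 2 * c * p + c\<^sup>2 * q" for c
    proof -
      have "v \<bullet> T (T v) = T v \<bullet> T v"
        by (simp add: T_sym)
      then have "(v + c *\<^sub>R T v) \<bullet> T (v + c *\<^sub>R T v) = 2 * c * p + c\<^sup>2 * q"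
        using vTv
        by (simp add: T_add T_scale p_def q_def inner_add_left inner_add_right
            power2_eq_square algebra_simps)
      then show ?thesis
        using T_nonneg[of "v + c *\<^sub>R T v"] by simp
    qed
    have "q + 1 > 0"
      using q by simp
    \<comment> \<open>For \<open>q > 0\<close> the quadratic in \<open>c\<close> is minimal at
      \<open>- p / q\<close>; the denominator \<open>q + 1\<close> also covers \<open>q = 0\<close>
      and still gives a negative value.\<close>
    have "2 * (- p / (q + 1)) * p + (- p / (q + 1))\<^sup>2 * q = - (p\<^sup>2 * (q + 2)) / (q + 1)\<^sup>2"
      using \<open>q + 1 > 0\<close> by (simp add: power2_eq_square divide_simps) (simp add: algebra_simps)
    moreover have "p\<^sup>2 * (q + 2) / (q + 1)\<^sup>2 > 0"
      using p q by (intro divide_pos_pos mult_pos_pos) auto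
    ultimately show False
      using quad[of "- p / (q + 1)"] by simp
  qed
  then have "S v = a *\<^sub>R v"
    by (simp add: T_def)
  moreover have "v \<noteq> 0"
    using v by auto
  ultimately show ?thesis
    using that by blast
qed

section \<open>Real and Hermitian inner products\<close>

text \<open>This makes the real eigenvector lemma applicable over both fields.
  \<open>to_complex\<close> is additive and norm-preserving; polarization turns this into
  preservation of the real inner product.\<close>

lemma inner_eq_Re_hinner:
  fixes v w :: "'f::real_or_complex ^ 'n"
  shows "v \<bullet> w = Re (to_complex (hinner v w))"
proof -
  have to_complex_sum: "to_complex (sum f A) = (\<Sum>a\<in>A. to_complex (f a))"
    for f :: "'n \<Rightarrow> 'f" and A
    \<comment> \<open>Scaling by 0 gives \<open>to_complex 0 = 0\<close>, the value needed for empty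
      and infinite sums.\<close>
    using to_complex_scaleR[of 0 "0 :: 'f"]
    by (induction A rule: infinite_finite_induct) (simp_all add: to_complex_add)
  have "x \<bullet> y = Re (to_complex (fcnj x * y))" for x y :: 'f
  proof -
    have "x \<bullet> y = to_complex x \<bullet> to_complex y"
      unfolding dot_norm by (simp add: norm_to_complex flip: to_complex_add)
    then show ?thesis
      by (simp add: to_complex_mult to_complex_fcnj inner_complex_def)
  qed
  then show ?thesis
    by (simp add: inner_vec_def hinner_def to_complex_sum)
qed

lemma hinner_scale_right: "hinner v (c *s w) = c * hinner v w"
  by (simp add: hinner_def sum_distrib_left mult_ac)

lemma hinner_scale_left: "hinner (c *s v) w = fcnj c * hinner v w"
  by (simp add: hinner_def sum_distrib_left fcnj_mult mult_ac)

lemma hinner_sum_right_plain: "hinner v (\<Sum>a\<in>A. f a) = (\<Sum>a\<in>A. hinner v (f a))"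
  using hinner_sum_right[of v "\<lambda>_. 1" f A] by simp

lemma hinner_sum_left_plain: "hinner (\<Sum>a\<in>A. f a) v = (\<Sum>a\<in>A. hinner (f a) v)"
  by (metis (no_types, lifting) fcnj_hinner fcnj_sum hinner_sum_right_plain sum.cong)

lemma hinner_self: "hinner v v = of_real ((norm v)\<^sup>2)"
  by (simp add: hinner_def fcnj_mult_self norm_vec_def L2_set_def sum_nonneg)

lemma fcnj_of_real: "fcnj (of_real c) = of_real c"
  by (rule to_complex_eq_iff[THEN iffD1]) (simp add: to_complex_fcnj to_complex_of_real)

section \<open>Orthonormal systems and isometries onto subspaces\<close>

text \<open>Pairing a vanishing combination with \<open>\<Phi> i\<close> isolates its i-th
  coefficient. Injectivity is recorded separately because independence concerns only the image set;
  together they bound \<open>r\<close> by a dimension.\<close>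

lemma orthonormal_independent:
  fixes \<Phi> :: "nat \<Rightarrow> 'f::real_or_complex ^ 'n"
  assumes on: "\<And>i j. i < r \<Longrightarrow> j < r \<Longrightarrow> hinner (\<Phi> i) (\<Phi> j) = (if i = j then 1 else 0)"
  shows "inj_on \<Phi> {..<r}" "vec.independent (\<Phi> ` {..<r})"
proof -
  show inj: "inj_on \<Phi> {..<r}"
    using on by (metis inj_onI lessThan_iff zero_neq_one)
  show "vec.independent (\<Phi> ` {..<r})"
  proof (rule vec.independent_if_scalars_zero)
    fix c x
    assume 0: "(\<Sum>x\<in>\<Phi> ` {..<r}. c x *s x) = 0" and "x \<in> \<Phi> ` {..<r}"
    then obtain i where i: "i < r" "x = \<Phi> i"
      by auto
    have "0 = hinner (\<Phi> i) (\<Sum>j<r. c (\<Phi> j) *s \<Phi> j)"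
      using 0 by (simp add: sum.reindex[OF inj] hinner_def)
    also have "\<dots> = (\<Sum>j<r. if j = i then c (\<Phi> j) else 0)"
      unfolding hinner_sum_right using i on by (intro sum.cong) auto
    also have "\<dots> = c x"
      using i by simp
    finally show "c x = 0"
      by simp
  qed simp
qed

lemma isometry_onto_subspace:
  assumes "isometry_onto r \<Phi> W"
  shows "vec.subspace W" "vec.dim W = r"
proof -
  have on: "\<And>i j. i < r \<Longrightarrow> j < r \<Longrightarrow> hinner (\<Phi> i) (\<Phi> j) = (if i = j then 1 else 0)"
    using assms by (simp add: isometry_onto_def)
  have "W = vec.span (\<Phi> ` {..<r})"
  proof
    show "W \<subseteq> vec.span (\<Phi> ` {..<r})"
    proof
      fix w assume "w \<in> W"
      then obtain c where "w = (\<Sum>j<r. c j *s \<Phi> j)"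
        using assms unfolding isometry_onto_def by blast
      then show "w \<in> vec.span (\<Phi> ` {..<r})"
        by (simp only:) (intro vec.span_sum vec.span_scale vec.span_base imageI)
    qed
    show "vec.span (\<Phi> ` {..<r}) \<subseteq> W"
    proof
      fix w assume "w \<in> vec.span (\<Phi> ` {..<r})"
      then obtain c where "w = (\<Sum>x\<in>\<Phi> ` {..<r}. c x *s x)"
        by (auto simp: vec.span_finite)
      then have "w = (\<Sum>j<r. c (\<Phi> j) *s \<Phi> j)"
        using sum.reindex[OF orthonormal_independent(1)[OF on]] by (simp add: o_def)
      then show "w \<in> W"
        using isometry_onto_sum_mem[OF assms] by metis
    qed
  qed
  then show "vec.subspace W" "vec.dim W = r"
    using vec.dim_span_eq_card_independent[OF orthonormal_independent(2)[OF on]]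
      card_image[OF orthonormal_independent(1)[OF on]]
    by (simp_all add: vec.subspace_span)
qed

text \<open>A longest orthonormal system in \<open>W\<close> spans \<open>W\<close>: a vector
  outside its span would leave a nonzero residual orthogonal to the system, which could be
  normalised and appended. Lengths are bounded by \<open>vec.dim W\<close>, so a longest system
  exists.\<close>

lemma isometry_onto_exists:
  fixes W :: "('f::real_or_complex ^ 'n) set"
  assumes W: "vec.subspace W"
  obtains \<Phi> where "isometry_onto (vec.dim W) \<Phi> W"
proof -
  define on where "on r \<Phi> \<longleftrightarrow> (\<forall>i<r. \<Phi> i \<in> W) \<and>
      (\<forall>i<r. \<forall>j<r. hinner (\<Phi> i) (\<Phi> j) = (if i = j then 1 else 0))"
    for r and \<Phi> :: "nat \<Rightarrow> 'f ^ 'n"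
  have bound: "r \<le> vec.dim W" if "\<exists>\<Phi>. on r \<Phi>" for r
  proof -
    from that obtain \<Phi> where \<Phi>: "on r \<Phi>" ..
    then have "inj_on \<Phi> {..<r}" "vec.independent (\<Phi> ` {..<r})"
      using orthonormal_independent[of r \<Phi>] by (auto simp: on_def)
    moreover have "\<Phi> ` {..<r} \<subseteq> W"
      using \<Phi> by (auto simp: on_def)
    ultimately show ?thesis
      using vec.independent_card_le_dim[of "\<Phi> ` {..<r}" W] card_image[of \<Phi> "{..<r}"] by simp
  qed
  have ex: "\<exists>\<Phi>. on 0 \<Phi>"
    by (simp add: on_def)
  define r where "r = (GREATEST r. \<exists>\<Phi>. on r \<Phi>)"
  have "\<exists>\<Phi>. on r \<Phi>"
    unfolding r_def by (rule GreatestI_nat[of "\<lambda>r. \<exists>\<Phi>. on r \<Phi>", OF ex bound])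
  then obtain \<Phi> where \<Phi>: "on r \<Phi>" ..
  have max: "s \<le> r" if "on s \<Psi>" for s \<Psi>
    unfolding r_def
    by (rule Greatest_le_nat[of "\<lambda>r. \<exists>\<Phi>. on r \<Phi>", OF _ bound])
      (use that in blast)
  have iso: "isometry_onto r \<Phi> W"
    unfolding isometry_onto_def
  proof (intro conjI equalityI subsetI)
    show "\<forall>i<r. \<forall>j<r. hinner (\<Phi> i) (\<Phi> j) = (if i = j then 1 else 0)"
      using \<Phi> by (simp add: on_def)
    show "w \<in> W" if "w \<in> range (\<lambda>c. \<Sum>j<r. c j *s \<Phi> j)" for w
      using that \<Phi> by (auto simp: on_def intro!: vec.subspace_sum[OF W] vec.subspace_scale[OF W])
    fix w assume w: "w \<in> W"
    define u where "u = w - (\<Sum>j<r. hinner (\<Phi> j) w *s \<Phi> j)"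
    have "u \<in> W"
      unfolding u_def using w \<Phi>
      by (auto simp: on_def intro!: vec.subspace_diff[OF W] vec.subspace_sum[OF W]
          vec.subspace_scale[OF W])
    have orth: "hinner (\<Phi> i) u = 0" if "i < r" for i
    proof -
      have "(\<Sum>j<r. hinner (\<Phi> j) w * hinner (\<Phi> i) (\<Phi> j)) = (\<Sum>j<r. if j = i then hinner (\<Phi> j) w else 0)"
        using that \<Phi> by (intro sum.cong) (auto simp: on_def)
      then show ?thesis
        using that by (simp add: u_def hinner_diff_right hinner_sum_right)
    qed
    then have orth': "hinner u (\<Phi> i) = 0" if "i < r" for i
      using that fcnj_hinner[of "\<Phi> i" u] by (simp add: fcnj_zero)
    have "u = 0"
    proof (rule ccontr)
      assume "u \<noteq> 0"
      define e where "e = of_real (1 / norm u) *s u"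
      have "hinner e e = of_real (1 / norm u * (1 / norm u) * (norm u)\<^sup>2)"
        unfolding e_def hinner_scale_left hinner_scale_right fcnj_of_real hinner_self[of u]
        by (simp only: of_real_mult mult.assoc)
      also have "\<dots> = 1"
        using \<open>u \<noteq> 0\<close> by (simp add: power2_eq_square)
      finally have "hinner e e = 1" .
      moreover have "e \<in> W"
        unfolding e_def by (rule vec.subspace_scale[OF W \<open>u \<in> W\<close>])
      moreover have "hinner (\<Phi> i) e = 0" "hinner e (\<Phi> i) = 0" if "i < r" for i
        using that by (simp_all add: e_def hinner_scale_left hinner_scale_right orth orth')
      \<comment> \<open>Index \<open>r\<close> lies just past the current system, so overwriting it
        keeps all old columns.\<close>
      ultimately have "on (Suc r) (\<Phi>(r := e))"
        using \<Phi> by (auto simp: on_def less_Suc_eq)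
      then show False
        using max[of "Suc r"] by fastforce
    qed
    then show "w \<in> range (\<lambda>c. \<Sum>j<r. c j *s \<Phi> j)"
      by (auto simp: u_def)
  qed
  then show ?thesis
    using that isometry_onto_subspace(2) by metis
qed

section \<open>Orthogonal projections\<close>

lemma orth_proj_mem:
  assumes "vec.subspace W"
  shows "orth_proj W v \<in> W"
proof -
  obtain \<Phi> where "isometry_onto (vec.dim W) \<Phi> W"
    using isometry_onto_exists[OF assms] .
  then show ?thesis
    by (simp add: orth_proj_isometry isometry_onto_sum_mem)
qed

lemma hinner_orth_proj:
  assumes "vec.subspace W" "w \<in> W"
  shows "hinner w (orth_proj W v) = hinner w v"
proof -
  obtain \<Phi> where "isometry_onto (vec.dim W) \<Phi> W"
    using isometry_onto_exists[OF assms(1)] .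
  then show ?thesis
    using assms(2) by (simp add: orth_proj_isometry isometry_onto_hinner_sum)
qed

text \<open>Both sides equal \<open>hinner (orth_proj W u) (orth_proj W v)\<close>.\<close>

lemma orth_proj_selfadjoint:
  assumes "vec.subspace W"
  shows "hinner (orth_proj W u) v = hinner u (orth_proj W v)"
  by (metis assms fcnj_hinner hinner_orth_proj orth_proj_mem)

lemma orth_proj_linear:
  fixes W :: "('f::real_or_complex ^ 'n) set"
  assumes "vec.subspace W"
  shows "Vector_Spaces.linear (*s) (*s) (orth_proj W)"
proof -
  obtain \<Phi> where \<Phi>: "isometry_onto (vec.dim W) \<Phi> W"
    using isometry_onto_exists[OF assms] .
  have "hinner v (x + y) = hinner v x + hinner v y" for v x y :: "'f ^ 'n"
    by (simp add: hinner_def algebra_simps sum.distrib)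
  then show ?thesis
    unfolding orth_proj_isometry[OF \<Phi>]
    by (intro Vector_Spaces.linear_iff[THEN iffD2])
      (simp add: hinner_scale_right vec.vector_space_axioms sum.distrib vec.scale_left_distrib vec.scale_sum_right)
qed

section \<open>Symmetry in the two subspaces\<close>

text \<open>In matrix terms, a square matrix that is a multiple of an isometry has the same property
  for its adjoint, with the same constant. Coordinate-free, the hypothesis says that projecting
  \<open>W\<close> to \<open>V\<close> and back is multiplication by
  \<open>\<alpha>\<close>.\<close>

lemma isoclinic_with_sym:
  assumes "isoclinic_with \<alpha> V W"
  shows "isoclinic_with \<alpha> W V"
proof -
  obtain r \<Phi> \<Psi> where \<Phi>: "isometry_onto r \<Phi> V" and \<Psi>: "isometry_onto r \<Psi> W"
    using assms unfolding isoclinic_with_def by blast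
  note V = isometry_onto_subspace[OF \<Phi>] and W = isometry_onto_subspace[OF \<Psi>]
  have VW: "hinner u (orth_proj V w) = \<alpha> * hinner u w" if "u \<in> W" "w \<in> W" for u w
    using assms that unfolding isoclinic_with_iff[OF \<Phi> \<Psi>] gram_scalar_iff[OF \<Phi> \<Psi>] by blast
  have "hinner u (orth_proj W v) = \<alpha> * hinner u v" if u: "u \<in> V" and v: "v \<in> V" for u v
  proof (cases "\<alpha> = 0")
    case True
    \<comment> \<open>The squared norm of \<open>orth_proj V w\<close> is
      \<open>hinner w (orth_proj V w)\<close>, hence \<open>\<alpha> * hinner w w = 0\<close>; the
      two subspaces are orthogonal.\<close>
    have 0: "orth_proj V w = 0" if "w \<in> W" for w
    proof -
      have "hinner (orth_proj V w) (orth_proj V w) = 0"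
        using VW[OF that that] True hinner_orth_proj[OF V(1) orth_proj_mem[OF V(1)], of w w]
          orth_proj_selfadjoint[OF V(1), of w w] by simp
      then show ?thesis
        by (simp add: hinner_self_eq_zero)
    qed
    have "hinner u (orth_proj W v) = hinner u (orth_proj V (orth_proj W v))"
      using u V by (simp add: hinner_orth_proj)
    then show ?thesis
      using 0[OF orth_proj_mem[OF W(1)]] True by (simp add: hinner_def)
  next
    case False
    have scal: "orth_proj W (orth_proj V w) = \<alpha> *s w" if "w \<in> W" for w
    proof -
      let ?d = "orth_proj W (orth_proj V w) - \<alpha> *s w"
      have "?d \<in> W"
        using W that by (intro vec.subspace_diff vec.subspace_scale orth_proj_mem)
      then have "hinner ?d ?d = 0"
        using W that VW[of ?d w]
        by (simp add: hinner_diff_right hinner_scale_right hinner_orth_proj)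
      then show ?thesis
        by (simp add: hinner_self_eq_zero)
    qed
    \<comment> \<open>The projection onto \<open>V\<close> is injective on \<open>W\<close>, hence maps \<open>W\<close> onto \<open>V\<close> for dimension
      reasons.\<close>
    have "inj_on (orth_proj V) W"
      using scal False by (metis inj_onI vec.scale_left_imp_eq)
    then have "vec.dim (orth_proj V ` W) = vec.dim W"
      using orth_proj_linear[OF V(1)] W(1) by (intro vec.dim_image_eq) (auto simp: vec.span_eq_iff[THEN iffD2])
    then have "orth_proj V ` W = V"
      using V W orth_proj_mem[OF V(1)]
      by (intro vec.subspace_dim_equal vec.linear_subspace_image orth_proj_linear) auto
    then obtain w where w: "w \<in> W" "v = orth_proj V w"
      using v by blast
    \<comment> \<open>Here \<open>orth_proj W v = \<alpha> *s w\<close>, and pairing with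
      \<open>u\<close> in \<open>V\<close> does not distinguish \<open>w\<close> from its projection
      \<open>v\<close>.\<close>
    then show ?thesis
      by (simp add: scal hinner_scale_right hinner_orth_proj[OF V(1) u])
  qed
  then show ?thesis
    unfolding isoclinic_with_iff[OF \<Psi> \<Phi>] gram_scalar_iff[OF \<Psi> \<Phi>] by blast
qed

text \<open>Exchanging the subspaces replaces the cross-Gram matrix by its conjugate transpose,
  which has the same Frobenius norm. Equal dimensions provide isometries with a common
  \<open>r\<close>.\<close>

lemma chordal_dist_sym:
  assumes "vec.subspace V" "vec.subspace W" "vec.dim V = vec.dim W"
  shows "chordal_dist V W = chordal_dist W V"
proof -
  obtain \<Phi> \<Psi> where "isometry_onto (vec.dim W) \<Phi> V" "isometry_onto (vec.dim W) \<Psi> W"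
    using isometry_onto_exists assms by metis
  then show ?thesis
    using cross_norm_commute[of "vec.dim W" "vec.dim W" \<Phi> \<Psi>]
    by (simp add: chordal_dist_eq cross_norm_def)
qed

section \<open>Invariance under unitaries\<close>

lemma hinner_unitary:
  assumes "U \<in> carrier unitary_group"
  shows "hinner (U *v v) (U *v w) = hinner v w"
proof -
  have adj: "hinner (U *v v) x = hinner v (conj_transpose U *v x)" for x
  proof -
    have "hinner (U *v v) x = (\<Sum>i\<in>UNIV. \<Sum>j\<in>UNIV. fcnj (U $ i $ j) * fcnj (v $ j) * x $ i)"
      by (simp add: hinner_def matrix_vector_mult_def fcnj_sum fcnj_mult sum_distrib_right)
    also have "\<dots> = hinner v (conj_transpose U *v x)"
      by (subst sum.swap)
        (simp add: hinner_def matrix_vector_mult_def conj_transpose_def sum_distrib_left mult_ac)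
    finally show ?thesis .
  qed
  show ?thesis
    using assms by (simp add: adj matrix_vector_mul_assoc unitary_group_def)
qed

text \<open>Projections, the isoclinic relation and chordal distance are all computed from
  isometries, so transporting isometries by \<open>U\<close> and applying
  \<open>hinner_unitary\<close> gives their invariance.\<close>

lemma isometry_onto_unitary:
  assumes U: "U \<in> carrier unitary_group" and \<Phi>: "isometry_onto r \<Phi> W"
  shows "isometry_onto r (\<lambda>i. U *v \<Phi> i) ((*v) U ` W)"
proof -
  have "U *v (\<Sum>j<r. c j *s \<Phi> j) = (\<Sum>j<r. c j *s (U *v \<Phi> j))" for c
    by (simp add: vec.linear_sum[OF matrix_vector_mul_linear_gen] vec.scale)
  then have "(*v) U ` range (\<lambda>c. \<Sum>j<r. c j *s \<Phi> j) = range (\<lambda>c. \<Sum>j<r. c j *s (U *v \<Phi> j))"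
    by (simp add: image_image)
  then show ?thesis
    using \<Phi> by (simp add: isometry_onto_def hinner_unitary[OF U])
qed

lemma orth_proj_unitary:
  assumes U: "U \<in> carrier unitary_group" and "vec.subspace W"
  shows "orth_proj ((*v) U ` W) (U *v v) = U *v orth_proj W v"
proof -
  obtain \<Phi> where \<Phi>: "isometry_onto (vec.dim W) \<Phi> W"
    using isometry_onto_exists[OF assms(2)] .
  show ?thesis
    unfolding orth_proj_isometry[OF \<Phi>] orth_proj_isometry[OF isometry_onto_unitary[OF U \<Phi>]]
    by (simp add: hinner_unitary[OF U] vec.linear_sum[OF matrix_vector_mul_linear_gen] vec.scale)
qed

lemma dim_unitary:
  assumes U: "U \<in> carrier unitary_group" and "vec.subspace W"
  shows "vec.subspace ((*v) U ` W)" "vec.dim ((*v) U ` W) = vec.dim W"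
proof -
  obtain \<Phi> where "isometry_onto (vec.dim W) \<Phi> W"
    using isometry_onto_exists[OF assms(2)] .
  from isometry_onto_subspace[OF isometry_onto_unitary[OF U this]]
  show "vec.subspace ((*v) U ` W)" "vec.dim ((*v) U ` W) = vec.dim W" .
qed

lemma isoclinic_with_unitary:
  assumes U: "U \<in> carrier unitary_group" and "isoclinic_with \<alpha> V W"
  shows "isoclinic_with \<alpha> ((*v) U ` V) ((*v) U ` W)"
proof -
  obtain r \<Phi> \<Psi> where "isometry_onto r \<Phi> V" "isometry_onto r \<Psi> W"
    and gram: "\<forall>i<r. \<forall>j<r. (\<Sum>k<r. fcnj (cross_gram \<Phi> \<Psi> k i) * cross_gram \<Phi> \<Psi> k j) =
        (if i = j then \<alpha> else 0)"
    using assms(2) unfolding isoclinic_with_def by blast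
  note iso = this(1,2)[THEN isometry_onto_unitary[OF U]]
  show ?thesis
    unfolding isoclinic_with_iff[OF iso] using gram by (simp add: cross_gram_def hinner_unitary[OF U])
qed

lemma chordal_dist_unitary:
  assumes U: "U \<in> carrier unitary_group"
    and "vec.subspace V" "vec.subspace W" "vec.dim V = vec.dim W"
  shows "chordal_dist ((*v) U ` V) ((*v) U ` W) = chordal_dist V W"
proof -
  obtain \<Phi> \<Psi> where iso: "isometry_onto (vec.dim W) \<Phi> V" "isometry_onto (vec.dim W) \<Psi> W"
    using isometry_onto_exists assms by metis
  show ?thesis
    unfolding chordal_dist_eq[OF iso] chordal_dist_eq[OF iso[THEN isometry_onto_unitary[OF U]]]
    by (simp add: cross_gram_def hinner_unitary[OF U])
qed

section \<open>Schur's lemma for self-adjoint operators\<close>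

text \<open>
  Self-adjointness is what makes this hold over \<open>\<real>\<close> as well: there, the commutant of an
  irreducible representation may be larger than the scalars.
\<close>

lemma Schur_selfadjoint:
  fixes S :: "'f::real_or_complex ^ 'n \<Rightarrow> 'f ^ 'n"
  assumes irr: "irreducible_unitary_rep G \<rho>"
    and lin: "Vector_Spaces.linear (*s) (*s) S"
    and sym: "\<And>u v. hinner (S u) v = hinner u (S v)"
    and comm: "\<And>g v. g \<in> carrier G \<Longrightarrow> S (\<rho> g *v v) = \<rho> g *v S v"
  obtains a where "\<And>v. S v = a *s v"
proof -
  \<comment> \<open>Real scaling is scaling by \<open>of_real c\<close>, so an operator linear over
    the field is also real-linear.\<close>
  have scaleR: "c *\<^sub>R v = of_real c *s v" for c :: real and v :: "'f ^ 'n"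
    by (simp add: vec_eq_iff flip: scaleR_conv_of_real)
  have "linear S"
    using lin by (intro linearI) (simp_all add: scaleR vec.linear_add vec.linear_scale)
  moreover have "S u \<bullet> v = u \<bullet> S v" for u v
    by (simp add: inner_eq_Re_hinner sym)
  ultimately obtain a v where v: "v \<noteq> 0" "S v = a *\<^sub>R v"
    using selfadjoint_has_eigenvector by blast
  \<comment> \<open>The eigenvector was found over the reals, but its eigenspace is formed over the
    field, so that irreducibility applies to it.\<close>
  define E where "E = {v. S v = of_real a *s v}"
  have "vec.subspace E"
    by (auto simp: E_def vec.subspace_def vec.linear_0[OF lin] vec.linear_add[OF lin]
        vec.linear_scale[OF lin] vec.scale_right_distrib mult.commute)
  moreover have "(*v) (\<rho> g) ` E \<subseteq> E" if "g \<in> carrier G" for g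
    using that by (auto simp: E_def comm vec.scale)
  ultimately have "E = {0} \<or> E = UNIV"
    using irr unfolding irreducible_unitary_rep_def by blast
  moreover have "v \<in> E"
    using v by (simp add: E_def scaleR)
  ultimately have "E = UNIV"
    using v by blast
  then show ?thesis
    using that[of "of_real a"] by (auto simp: E_def)
qed

section \<open>The orbit ensemble of \<open>W\<close>\<close>

theorem theorem3p1:
  fixes G :: "('g, 'b) monoid_scheme"
    and X :: "'x set" and \<sigma> :: "'g \<Rightarrow> 'x \<Rightarrow> 'x" and x\<^sub>0 :: 'x
    and H :: "'g set" and t :: "'x \<Rightarrow> 'g"
    and \<rho> :: "'g \<Rightarrow> 'f::real_or_complex ^ 'n ^ 'n"
    and W :: "('f ^ 'n) set" and \<W> :: "'x \<Rightarrow> ('f ^ 'n) set"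
  assumes "finite (carrier G)" and "finite X"
    and "transitive_action G X \<sigma>"
    and "x\<^sub>0 \<in> X" and "H = stabilizer G \<sigma> x\<^sub>0"
    and "\<And>x. x \<in> X \<Longrightarrow> t x \<in> carrier G \<and> \<sigma> (t x) x\<^sub>0 = x"
    and "irreducible_unitary_rep G \<rho>"
    and "vec.subspace W" and "\<And>h. h \<in> H \<Longrightarrow> (*v) (\<rho> h) ` W = W"
    and "\<And>x. \<W> x = (*v) (\<rho> (t x)) ` W"
  shows "tight_fusion_frame X \<W> \<and>
    \<sigma> ` carrier G \<subseteq> ensemble_automorphisms X \<W> \<and>
    (doubly_homogeneous G X \<sigma> \<longrightarrow>
      equichordal_tight_fusion_frame X \<W> \<and>
      (card X \<ge> 2 \<longrightarrow>
        (equiisoclinic_tight_fusion_frame X \<W> \<longleftrightarrow>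
          (\<exists>g\<in>carrier G - H. isoclinic W ((*v) (\<rho> g) ` W)))))"
proof -
  note x\<^sub>0 = \<open>x\<^sub>0 \<in> X\<close> and H = \<open>H = stabilizer G \<sigma> x\<^sub>0\<close>
    and irr = \<open>irreducible_unitary_rep G \<rho>\<close> and W = \<open>vec.subspace W\<close>
    and t = assms(6) and HW = assms(9) and \<W> = assms(10)
  interpret transitive_action G X \<sigma>
    by (fact assms(3))
  interpret G: group G
    by (rule group_hom.axioms(1)[OF group_hom])
  have \<rho>_hom: "\<rho> \<in> hom G unitary_group"
    using irr by (simp add: irreducible_unitary_rep_def)
  have \<rho>: "\<rho> g \<in> carrier unitary_group" if "g \<in> carrier G" for g
    using \<rho>_hom that by (rule hom_in_carrier)
  have \<rho>_mult: "\<rho> (g \<otimes>\<^bsub>G\<^esub> h) = \<rho> g ** \<rho> h" if "g \<in> carrier G" "h \<in> carrier G" for g h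
    using hom_mult[OF \<rho>_hom that] by (simp add: unitary_group_def)
  have \<rho>_image: "(*v) (\<rho> (g \<otimes>\<^bsub>G\<^esub> h)) ` V = (*v) (\<rho> g) ` (*v) (\<rho> h) ` V"
    if "g \<in> carrier G" "h \<in> carrier G" for g h V
    using that by (simp add: \<rho>_mult image_image matrix_vector_mul_assoc)

  \<comment> \<open>Any \<open>g\<close> can replace the chosen representative of the point
    \<open>\<sigma> g x\<^sub>0\<close>: the two differ by an element of \<open>H\<close>, which
    preserves \<open>W\<close>.\<close>
  have \<W>_base: "\<W> (\<sigma> g x\<^sub>0) = (*v) (\<rho> g) ` W" if g: "g \<in> carrier G" for g
  proof -
    let ?x = "\<sigma> g x\<^sub>0"
    have x: "?x \<in> X"
      using element_image[OF g x\<^sub>0] by simp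
    note tx = t[OF x]
    let ?h = "inv\<^bsub>G\<^esub> (t ?x) \<otimes>\<^bsub>G\<^esub> g"
    have h: "?h \<in> carrier G"
      using tx g by simp
    have "\<sigma> ?h x\<^sub>0 = \<sigma> (inv\<^bsub>G\<^esub> (t ?x)) ?x"
      using composition_rule[OF x\<^sub>0, of "inv\<^bsub>G\<^esub> (t ?x)" g] tx g by simp
    also have "\<dots> = x\<^sub>0"
      using orbit_sym_aux[of "t ?x" x\<^sub>0 ?x] tx x\<^sub>0 by simp
    finally have "?h \<in> H"
      using h by (simp add: H stabilizer_def)
    moreover have "t ?x \<otimes>\<^bsub>G\<^esub> ?h = g"
      using tx g by (simp flip: G.m_assoc)
    ultimately show ?thesis
      using \<rho>_image[of "t ?x" ?h W] tx h HW by (simp add: \<W>)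
  qed
  \<comment> \<open>\<open>t x\<^sub>0\<close> need not be the identity, but it lies in
    \<open>H\<close>.\<close>
  have \<W>_x\<^sub>0: "\<W> x\<^sub>0 = W"
    using t[OF x\<^sub>0] HW[of "t x\<^sub>0"] by (simp add: \<W> H stabilizer_def)
  have \<W>_equivariant: "(*v) (\<rho> g) ` \<W> x = \<W> (\<sigma> g x)" if "g \<in> carrier G" "x \<in> X" for g x
    using \<W>_base[of "g \<otimes>\<^bsub>G\<^esub> t x"] composition_rule[OF x\<^sub>0, of g "t x"] t[OF \<open>x \<in> X\<close>] that
      \<rho>_image[of g "t x" W] by (simp add: \<W>)
  have sub: "vec.subspace (\<W> x)" and dim: "vec.dim (\<W> x) = vec.dim W" if "x \<in> X" for x
    using dim_unitary[OF \<rho> W] t[OF that] by (simp_all add: \<W>)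

  \<comment> \<open>Tightness via the frame operator\<close>
  define S where "S v = (\<Sum>x\<in>X. orth_proj (\<W> x) v)" for v
  have "S (\<rho> g *v v) = \<rho> g *v S v" if g: "g \<in> carrier G" for g v
  proof -
    \<comment> \<open>The permutation \<open>\<sigma> g\<close> of \<open>X\<close> reindexes the
      sum; equivariance then lets \<open>\<rho> g\<close> pass through every projection.\<close>
    have "S (\<rho> g *v v) = (\<Sum>x\<in>X. orth_proj (\<W> (\<sigma> g x)) (\<rho> g *v v))"
      unfolding S_def
      by (rule sum.reindex_bij_betw[symmetric])
        (use g in \<open>simp add: bij_betw_def inj_prop surj_prop\<close>)
    also have "\<dots> = (\<Sum>x\<in>X. \<rho> g *v orth_proj (\<W> x) v)"
      using g by (intro sum.cong) (simp_all flip: \<W>_equivariant add: orth_proj_unitary[OF \<rho>] sub)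
    finally show ?thesis
      by (simp add: S_def vec.linear_sum[OF matrix_vector_mul_linear_gen])
  qed
  moreover have "Vector_Spaces.linear (*s) (*s) S"
    unfolding S_def using sub by (intro vec.linear_compose_sum ballI orth_proj_linear)
  moreover have "hinner (S u) v = hinner u (S v)" for u v
    unfolding S_def hinner_sum_right_plain hinner_sum_left_plain
    using sub by (intro sum.cong) (simp_all add: orth_proj_selfadjoint)
  ultimately obtain a where "\<And>v. S v = a *s v"
    using Schur_selfadjoint[OF irr] by blast
  then have tight: "tight_fusion_frame X \<W>"
    unfolding tight_fusion_frame_def using sub dim by (auto simp: S_def)

  have "\<sigma> g \<in> carrier (BijGroup X)" if "g \<in> carrier G" for g
    using that group_hom.hom_closed[OF group_hom] by blast
  then have aut: "\<sigma> ` carrier G \<subseteq> ensemble_automorphisms X \<W>"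
    unfolding ensemble_automorphisms_def using \<rho> \<W>_equivariant by blast

  \<comment> \<open>Consequences of double homogeneity\<close>
  {
    assume dh: "doubly_homogeneous G X \<sigma>"
    \<comment> \<open>An elimination rule, to serve both distances and isoclinism. Only unordered
      pairs are matched, so the unitary may swap the points; the symmetry lemmas handle that
      case.\<close>
    have pair: thesis
      if "x \<in> X" "y \<in> X" "x \<noteq> y" "x' \<in> X" "y' \<in> X" "x' \<noteq> y'"
        and *: "\<And>U. U \<in> carrier unitary_group \<Longrightarrow>
          \<W> x' = (*v) U ` \<W> x \<and> \<W> y' = (*v) U ` \<W> y \<or>
          \<W> y' = (*v) U ` \<W> x \<and> \<W> x' = (*v) U ` \<W> y \<Longrightarrow> thesis"
      for x y x' y' thesis
    proof -
      obtain g where g: "g \<in> carrier G" "{\<sigma> g x, \<sigma> g y} = {x', y'}"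
        using dh \<open>x \<in> X\<close> \<open>y \<in> X\<close> \<open>x \<noteq> y\<close> \<open>x' \<in> X\<close> \<open>y' \<in> X\<close> \<open>x' \<noteq> y'\<close>
        unfolding doubly_homogeneous_def by blast
      show thesis
        using *[OF \<rho>[OF g(1)]] g(2) \<W>_equivariant[OF g(1) \<open>x \<in> X\<close>]
          \<W>_equivariant[OF g(1) \<open>y \<in> X\<close>] by (auto simp: doubleton_eq_iff)
    qed
    have "chordal_dist (\<W> x) (\<W> y) = chordal_dist (\<W> x') (\<W> y')"
      if "x \<in> X" "y \<in> X" "x \<noteq> y" "x' \<in> X" "y' \<in> X" "x' \<noteq> y'" for x y x' y'
      using that
      by (rule pair) (use that chordal_dist_unitary[of _ "\<W> x" "\<W> y"]
        chordal_dist_sym[of "\<W> x'" "\<W> y'"] sub dim in auto)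
    \<comment> \<open>Equality between any two pairs yields a common value; without two distinct
      points any value does.\<close>
    then have "equichordal_tight_fusion_frame X \<W>"
      unfolding equichordal_tight_fusion_frame_def using tight by metis
    moreover have "equiisoclinic_tight_fusion_frame X \<W> \<longleftrightarrow>
        (\<exists>g\<in>carrier G - H. isoclinic W ((*v) (\<rho> g) ` W))" if card: "card X \<ge> 2"
    proof
      assume "equiisoclinic_tight_fusion_frame X \<W>"
      then obtain \<alpha> where \<alpha>: "\<And>x y. x \<in> X \<Longrightarrow> y \<in> X \<Longrightarrow> x \<noteq> y \<Longrightarrow> isoclinic_with \<alpha> (\<W> x) (\<W> y)"
        unfolding equiisoclinic_tight_fusion_frame_def by blast
      \<comment> \<open>A second point \<open>y\<close> is needed: its representative
        \<open>t y\<close> moves \<open>x\<^sub>0\<close> and so lies outside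
        \<open>H\<close>.\<close>
      have "\<not> X \<subseteq> {x\<^sub>0}"
        using card card_mono[of "{x\<^sub>0}" X] by auto
      then obtain y where y: "y \<in> X" "y \<noteq> x\<^sub>0"
        by blast
      have "t y \<in> carrier G - H"
        using t[OF y(1)] y(2) by (simp add: H stabilizer_def)
      moreover have "isoclinic W ((*v) (\<rho> (t y)) ` W)"
        using \<alpha>[OF x\<^sub>0 y(1)] y(2) \<W>_x\<^sub>0 unfolding isoclinic_def \<W>[of y] by metis
      ultimately show "\<exists>g\<in>carrier G - H. isoclinic W ((*v) (\<rho> g) ` W)"
        by blast
    next
      assume "\<exists>g\<in>carrier G - H. isoclinic W ((*v) (\<rho> g) ` W)"
      then obtain g \<alpha> where g: "g \<in> carrier G" "g \<notin> H"
        and \<alpha>: "isoclinic_with \<alpha> W ((*v) (\<rho> g) ` W)"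
        unfolding isoclinic_def by blast
      let ?y = "\<sigma> g x\<^sub>0"
      have y: "?y \<in> X" "x\<^sub>0 \<noteq> ?y"
        using g element_image[OF g(1) x\<^sub>0] by (auto simp: H stabilizer_def)
      have iso: "isoclinic_with \<alpha> (\<W> x\<^sub>0) (\<W> ?y)"
        using \<alpha> \<W>_x\<^sub>0 \<W>_base[OF g(1)] by simp
      \<comment> \<open>The parameter \<open>\<alpha>\<close> of this one pair serves all pairs,
        since unitaries and swapping preserve it.\<close>
      have "isoclinic_with \<alpha> (\<W> x) (\<W> y)" if "x \<in> X" "y \<in> X" "x \<noteq> y" for x y
        using x\<^sub>0 y that
        by (rule pair) (use isoclinic_with_unitary[OF _ iso]
          isoclinic_with_sym[OF isoclinic_with_unitary[OF _ iso]] in auto)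
      then show "equiisoclinic_tight_fusion_frame X \<W>"
        unfolding equiisoclinic_tight_fusion_frame_def using tight by blast
    qed
    ultimately have "equichordal_tight_fusion_frame X \<W> \<and>
      (card X \<ge> 2 \<longrightarrow> (equiisoclinic_tight_fusion_frame X \<W> \<longleftrightarrow>
          (\<exists>g\<in>carrier G - H. isoclinic W ((*v) (\<rho> g) ` W))))"
      by blast
  }
  then show ?thesis
    using tight aut by blast
qed

end
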